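(* There exists an adjunction $\mathrm{Coll}\colon \mathbf{sBimod}\rightleftarrows \mathbf{2Cat}_2 \colon \mathrm{Chosen}$, with $\mathrm{Coll}$ left adjoint to $\mathrm{Chosen}$, where $\mathrm{Coll}$ sends a bimodular category to its collage with its two 0-cells $M,N$ as chosen 0-cells, and $\mathrm{Chosen}$ picks the hom-category between the two chosen 0-cells. Moreover, the unit of this adjunction is a natural isomorphism.
   Context: All monoidal categories, monoidal functors, monoidal actions, 2-categories and 2-functors are strict. Composition of 1-cells in a 2-category is written in diagrammatic order. A bimodular category $(\mathbb{C},\mathbb{M},\mathbb{N})$ is a category $\mathbb{C}$, monoidal categories $\mathbb{M}$ and $\mathbb{N}$, a left monoidal action $(\triangleright)\colon \mathbb{M}\times\mathbb{C}\to\mathbb{C}$ and a right monoidal action $(\triangleleft)\colon\mathbb{C}\times\mathbb{N}\to\mathbb{C}$, which are compatible: $M\triangleright(X\triangleleft N)=(M\triangleright X)\triangleleft N$ (on objects and on morphisms). The category $\mathbf{sBimod}$ has bimodular categories (over arbitrary monoidal categories) as objects; a morphism $(F,H,K)\colon(\mathbb{C},\mathbb{M},\mathbb{N})\to(\mathbb{D},\mathbb{P},\mathbb{Q})$ consists of monoidal functors $H\colon\mathbb{M}\to\mathbb{P}$, $K\colon\mathbb{N}\to\mathbb{Q}$ and a functor $F\colon\mathbb{C}\to\mathbb{D}$ strictly preserving the actions according to $H$ and $K$. The category $\mathbf{2Cat}_2$ of bipointed 2-categories has as objects triples $(\mathbb{A},M,N)$ of a 2-category $\mathbb{A}$ with two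 chosen 0-cells $M,N$ of $\mathbb{A}$; its morphisms are 2-functors preserving the chosen 0-cells. The collage $\mathrm{Coll}_{\mathbb{C}}$ of an $(\mathbb{M},\mathbb{N})$-bimodular category $\mathbb{C}$ is the 2-category with two 0-cells $M$ and $N$, hom-categories $\mathrm{Coll}_{\mathbb{C}}(M,M)=\mathbb{M}$, $\mathrm{Coll}_{\mathbb{C}}(N,N)=\mathbb{N}$, $\mathrm{Coll}_{\mathbb{C}}(M,N)=\mathbb{C}$, and $\mathrm{Coll}_{\mathbb{C}}(N,M)$ the empty category; composition of 1-cells is given by the monoidal products and the actions. For $(\mathbb{A},M,N)$ in $\mathbf{2Cat}_2$, $\mathrm{Chosen}(\mathbb{A},M,N)$ is the hom-category $\mathbb{A}(M,N)$, regarded as an $(\mathbb{A}(M,M),\mathbb{A}(N,N))$-bimodular category, with monoidal products and actions given by composition in $\mathbb{A}$. *)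

theory Defs
  imports Main "HOL-Library.FuncSet"
begin

text \<open>
  All structures below are kept extensional: every operation takes the value undefined outside its
  domain. Hence equality of HOL terms is equality of the mathematical structures, and of functors
  in particular.
\<close>

record ('o, 'm) cat =
  Obj :: "'o set"
  Arr :: "'m set"
  Dom :: "'m \<Rightarrow> 'o"
  Cod :: "'m \<Rightarrow> 'o"
  Idn :: "'o \<Rightarrow> 'm"
  Cmp :: "'m \<Rightarrow> 'm \<Rightarrow> 'm" \<comment> \<open>\<open>Cmp C g f\<close> is \<open>g\<close> after \<open>f\<close>\<close>

definition composable :: "('o, 'm) cat \<Rightarrow> 'm \<Rightarrow> 'm \<Rightarrow> bool" where
  "composable C g f \<longleftrightarrow> g \<in> Arr C \<and> f \<in> Arr C \<and> Dom C g = Cod C f"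

definition category :: "('o, 'm) cat \<Rightarrow> bool" where
  "category C \<longleftrightarrow>
     Dom C \<in> Arr C \<rightarrow>\<^sub>E Obj C \<and> Cod C \<in> Arr C \<rightarrow>\<^sub>E Obj C \<and> Idn C \<in> Obj C \<rightarrow>\<^sub>E Arr C \<and>
     (\<forall>x\<in>Obj C. Dom C (Idn C x) = x \<and> Cod C (Idn C x) = x) \<and>
     (\<forall>g f. composable C g f \<longrightarrow>
        Cmp C g f \<in> Arr C \<and> Dom C (Cmp C g f) = Dom C f \<and> Cod C (Cmp C g f) = Cod C g) \<and>
     (\<forall>g f. \<not> composable C g f \<longrightarrow> Cmp C g f = undefined) \<and>
     (\<forall>f\<in>Arr C. Cmp C f (Idn C (Dom C f)) = f \<and> Cmp C (Idn C (Cod C f)) f = f) \<and>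
     (\<forall>h g f. composable C h g \<longrightarrow> composable C g f \<longrightarrow>
        Cmp C h (Cmp C g f) = Cmp C (Cmp C h g) f)"

definition empty_cat :: "('o, 'm) cat" where
  "empty_cat = \<lparr>Obj = {}, Arr = {}, Dom = (\<lambda>_. undefined), Cod = (\<lambda>_. undefined),
     Idn = (\<lambda>_. undefined), Cmp = (\<lambda>_ _. undefined)\<rparr>"

definition prod_cat :: "('o, 'm) cat \<Rightarrow> ('p, 'n) cat \<Rightarrow> ('o \<times> 'p, 'm \<times> 'n) cat" where
  "prod_cat C D =
    \<lparr>Obj = Obj C \<times> Obj D, Arr = Arr C \<times> Arr D,
     Dom = (\<lambda>u\<in>Arr C \<times> Arr D. (Dom C (fst u), Dom D (snd u))),
     Cod = (\<lambda>u\<in>Arr C \<times> Arr D. (Cod C (fst u), Cod D (snd u))),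
     Idn = (\<lambda>x\<in>Obj C \<times> Obj D. (Idn C (fst x), Idn D (snd x))),
     Cmp = (\<lambda>v u. if composable C (fst v) (fst u) \<and> composable D (snd v) (snd u)
        then (Cmp C (fst v) (fst u), Cmp D (snd v) (snd u)) else undefined)\<rparr>"

record ('o, 'm, 'p, 'n) funct =
  FO :: "'o \<Rightarrow> 'p"
  FA :: "'m \<Rightarrow> 'n"

definition is_functor :: "('o, 'm) cat \<Rightarrow> ('p, 'n) cat \<Rightarrow> ('o, 'm, 'p, 'n) funct \<Rightarrow> bool" where
  "is_functor C D F \<longleftrightarrow>
     category C \<and> category D \<and>
     FO F \<in> Obj C \<rightarrow>\<^sub>E Obj D \<and> FA F \<in> Arr C \<rightarrow>\<^sub>E Arr D \<and>
     (\<forall>f\<in>Arr C. Dom D (FA F f) = FO F (Dom C f) \<and> Cod D (FA F f) = FO F (Cod C f)) \<and>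
     (\<forall>x\<in>Obj C. FA F (Idn C x) = Idn D (FO F x)) \<and>
     (\<forall>g f. composable C g f \<longrightarrow> FA F (Cmp C g f) = Cmp D (FA F g) (FA F f))"

definition id_functor :: "('o, 'm) cat \<Rightarrow> ('o, 'm, 'o, 'm) funct" where
  "id_functor C = \<lparr>FO = (\<lambda>x\<in>Obj C. x), FA = (\<lambda>f\<in>Arr C. f)\<rparr>"

text \<open>\<open>comp_functor C G F\<close> is \<open>G\<close> after \<open>F\<close>, where \<open>C\<close> is the domain of \<open>F\<close>.\<close>

definition comp_functor ::
    "('o, 'm) cat \<Rightarrow> ('p, 'n, 'q, 'l) funct \<Rightarrow> ('o, 'm, 'p, 'n) funct \<Rightarrow> ('o, 'm, 'q, 'l) funct" where
  "comp_functor C G F =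
    \<lparr>FO = compose (Obj C) (FO G) (FO F), FA = compose (Arr C) (FA G) (FA F)\<rparr>"

definition empty_functor :: "('o, 'm, 'p, 'n) funct" where
  "empty_functor = \<lparr>FO = (\<lambda>_. undefined), FA = (\<lambda>_. undefined)\<rparr>"

definition nat_trans ::
    "('o, 'm) cat \<Rightarrow> ('p, 'n) cat \<Rightarrow> ('o, 'm, 'p, 'n) funct \<Rightarrow> ('o, 'm, 'p, 'n) funct \<Rightarrow>
     ('o \<Rightarrow> 'n) \<Rightarrow> bool" where
  "nat_trans C D F G \<eta> \<longleftrightarrow>
     is_functor C D F \<and> is_functor C D G \<and> \<eta> \<in> Obj C \<rightarrow>\<^sub>E Arr D \<and>
     (\<forall>x\<in>Obj C. Dom D (\<eta> x) = FO F x \<and> Cod D (\<eta> x) = FO G x) \<and>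
     (\<forall>f\<in>Arr C. Cmp D (FA G f) (\<eta> (Dom C f)) = Cmp D (\<eta> (Cod C f)) (FA F f))"

definition is_iso :: "('o, 'm) cat \<Rightarrow> 'm \<Rightarrow> bool" where
  "is_iso C f \<longleftrightarrow> f \<in> Arr C \<and>
     (\<exists>g\<in>Arr C. Dom C g = Cod C f \<and> Cod C g = Dom C f \<and>
        Cmp C g f = Idn C (Dom C f) \<and> Cmp C f g = Idn C (Cod C f))"

definition nat_iso ::
    "('o, 'm) cat \<Rightarrow> ('p, 'n) cat \<Rightarrow> ('o, 'm, 'p, 'n) funct \<Rightarrow> ('o, 'm, 'p, 'n) funct \<Rightarrow>
     ('o \<Rightarrow> 'n) \<Rightarrow> bool" where
  "nat_iso C D F G \<eta> \<longleftrightarrow> nat_trans C D F G \<eta> \<and> (\<forall>x\<in>Obj C. is_iso D (\<eta> x))"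

text \<open>\<open>L\<close> is left adjoint to \<open>R\<close>, with unit \<open>\<eta>\<close> and counit \<open>\<epsilon>\<close>.\<close>

definition adjunction ::
    "('o, 'm) cat \<Rightarrow> ('p, 'n) cat \<Rightarrow> ('o, 'm, 'p, 'n) funct \<Rightarrow> ('p, 'n, 'o, 'm) funct \<Rightarrow>
     ('o \<Rightarrow> 'm) \<Rightarrow> ('p \<Rightarrow> 'n) \<Rightarrow> bool" where
  "adjunction C D L R \<eta> \<epsilon> \<longleftrightarrow>
     is_functor C D L \<and> is_functor D C R \<and>
     nat_trans C C (id_functor C) (comp_functor C R L) \<eta> \<and>
     nat_trans D D (comp_functor D L R) (id_functor D) \<epsilon> \<and>
     (\<forall>x\<in>Obj C. Cmp D (\<epsilon> (FO L x)) (FA L (\<eta> x)) = Idn D (FO L x)) \<and>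
     (\<forall>y\<in>Obj D. Cmp C (FA R (\<epsilon> y)) (\<eta> (FO R y)) = Idn C (FO R y))"

text \<open>
  Categories of structures: an arrow carries its source and target, so that domain and codomain
  are determined by the arrow. \<open>hom x y\<close> is the set of structure-preserving maps; the composition
  \<open>cmp x g f\<close> of extensional maps refers to the source \<open>x\<close> of \<open>f\<close>.
\<close>

datatype ('a, 'd) arrow = Arrow (Source: 'a) (Map: 'd) (Target: 'a)

definition concrete_cat ::
    "'a set \<Rightarrow> ('a \<Rightarrow> 'a \<Rightarrow> 'd set) \<Rightarrow> ('a \<Rightarrow> 'd) \<Rightarrow> ('a \<Rightarrow> 'd \<Rightarrow> 'd \<Rightarrow> 'd) \<Rightarrow> ('a, ('a, 'd) arrow) cat" where
  "concrete_cat S hom idn cmp =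
    (let A = {f. Source f \<in> S \<and> Target f \<in> S \<and> Map f \<in> hom (Source f) (Target f)} in
     \<lparr>Obj = S, Arr = A, Dom = restrict Source A, Cod = restrict Target A,
      Idn = (\<lambda>x\<in>S. Arrow x (idn x) x),
      Cmp = (\<lambda>g f. if g \<in> A \<and> f \<in> A \<and> Source g = Target f
        then Arrow (Source f) (cmp (Source f) (Map g) (Map f)) (Target g) else undefined)\<rparr>)"

record ('o, 'm) moncat =
  Under :: "('o, 'm) cat"
  Tensor :: "('o \<times> 'o, 'm \<times> 'm, 'o, 'm) funct"
  Unit :: 'o

definition monoidal_category :: "('o, 'm) moncat \<Rightarrow> bool" where
  "monoidal_category M \<longleftrightarrow>
    (let C = Under M; T = Tensor M; I = Unit M in
     category C \<and> is_functor (prod_cat C C) C T \<and> I \<in> Obj C \<and>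
     (\<forall>x\<in>Obj C. \<forall>y\<in>Obj C. \<forall>z\<in>Obj C. FO T (FO T (x, y), z) = FO T (x, FO T (y, z))) \<and>
     (\<forall>f\<in>Arr C. \<forall>g\<in>Arr C. \<forall>h\<in>Arr C. FA T (FA T (f, g), h) = FA T (f, FA T (g, h))) \<and>
     (\<forall>x\<in>Obj C. FO T (I, x) = x \<and> FO T (x, I) = x) \<and>
     (\<forall>f\<in>Arr C. FA T (Idn C I, f) = f \<and> FA T (f, Idn C I) = f))"

definition monoidal_functor ::
    "('o, 'm) moncat \<Rightarrow> ('p, 'n) moncat \<Rightarrow> ('o, 'm, 'p, 'n) funct \<Rightarrow> bool" where
  "monoidal_functor M P H \<longleftrightarrow>
     is_functor (Under M) (Under P) H \<and>
     (\<forall>x\<in>Obj (Under M). \<forall>y\<in>Obj (Under M).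
        FO H (FO (Tensor M) (x, y)) = FO (Tensor P) (FO H x, FO H y)) \<and>
     (\<forall>f\<in>Arr (Under M). \<forall>g\<in>Arr (Under M).
        FA H (FA (Tensor M) (f, g)) = FA (Tensor P) (FA H f, FA H g)) \<and>
     FO H (Unit M) = Unit P"

definition left_action ::
    "('o, 'm) moncat \<Rightarrow> ('p, 'n) cat \<Rightarrow> ('o \<times> 'p, 'm \<times> 'n, 'p, 'n) funct \<Rightarrow> bool" where
  "left_action M C L \<longleftrightarrow>
     is_functor (prod_cat (Under M) C) C L \<and>
     (\<forall>x\<in>Obj (Under M). \<forall>y\<in>Obj (Under M). \<forall>c\<in>Obj C.
        FO L (FO (Tensor M) (x, y), c) = FO L (x, FO L (y, c))) \<and>
     (\<forall>f\<in>Arr (Under M). \<forall>g\<in>Arr (Under M). \<forall>u\<in>Arr C.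
        FA L (FA (Tensor M) (f, g), u) = FA L (f, FA L (g, u))) \<and>
     (\<forall>c\<in>Obj C. FO L (Unit M, c) = c) \<and>
     (\<forall>u\<in>Arr C. FA L (Idn (Under M) (Unit M), u) = u)"

definition right_action ::
    "('o, 'm) moncat \<Rightarrow> ('p, 'n) cat \<Rightarrow> ('p \<times> 'o, 'n \<times> 'm, 'p, 'n) funct \<Rightarrow> bool" where
  "right_action N C R \<longleftrightarrow>
     is_functor (prod_cat C (Under N)) C R \<and>
     (\<forall>c\<in>Obj C. \<forall>x\<in>Obj (Under N). \<forall>y\<in>Obj (Under N).
        FO R (c, FO (Tensor N) (x, y)) = FO R (FO R (c, x), y)) \<and>
     (\<forall>u\<in>Arr C. \<forall>f\<in>Arr (Under N). \<forall>g\<in>Arr (Under N).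
        FA R (u, FA (Tensor N) (f, g)) = FA R (FA R (u, f), g)) \<and>
     (\<forall>c\<in>Obj C. FO R (c, Unit N) = c) \<and>
     (\<forall>u\<in>Arr C. FA R (u, Idn (Under N) (Unit N)) = u)"

text \<open>
  The three categories may be arbitrary categories with objects in \<open>'o\<close> and arrows in \<open>'m\<close>;
  these types play the role of the universe of smallness.
\<close>

record ('o, 'm) bimod =
  Carrier :: "('o, 'm) cat"
  LMon :: "('o, 'm) moncat"
  RMon :: "('o, 'm) moncat"
  LAct :: "('o \<times> 'o, 'm \<times> 'm, 'o, 'm) funct"
  RAct :: "('o \<times> 'o, 'm \<times> 'm, 'o, 'm) funct"

definition bimodular_category :: "('o, 'm) bimod \<Rightarrow> bool" where
  "bimodular_category B \<longleftrightarrow>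
     category (Carrier B) \<and> monoidal_category (LMon B) \<and> monoidal_category (RMon B) \<and>
     left_action (LMon B) (Carrier B) (LAct B) \<and> right_action (RMon B) (Carrier B) (RAct B) \<and>
     (\<forall>x\<in>Obj (Under (LMon B)). \<forall>c\<in>Obj (Carrier B). \<forall>y\<in>Obj (Under (RMon B)).
        FO (LAct B) (x, FO (RAct B) (c, y)) = FO (RAct B) (FO (LAct B) (x, c), y)) \<and>
     (\<forall>f\<in>Arr (Under (LMon B)). \<forall>u\<in>Arr (Carrier B). \<forall>g\<in>Arr (Under (RMon B)).
        FA (LAct B) (f, FA (RAct B) (u, g)) = FA (RAct B) (FA (LAct B) (f, u), g))"

record ('o, 'm) bimod_map =
  FMap :: "('o, 'm, 'o, 'm) funct"
  HMap :: "('o, 'm, 'o, 'm) funct"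
  KMap :: "('o, 'm, 'o, 'm) funct"

definition bimod_morphism ::
    "('o, 'm) bimod \<Rightarrow> ('o, 'm) bimod \<Rightarrow> ('o, 'm) bimod_map \<Rightarrow> bool" where
  "bimod_morphism B B' \<phi> \<longleftrightarrow>
    (let F = FMap \<phi>; H = HMap \<phi>; K = KMap \<phi> in
     is_functor (Carrier B) (Carrier B') F \<and>
     monoidal_functor (LMon B) (LMon B') H \<and> monoidal_functor (RMon B) (RMon B') K \<and>
     (\<forall>x\<in>Obj (Under (LMon B)). \<forall>c\<in>Obj (Carrier B).
        FO F (FO (LAct B) (x, c)) = FO (LAct B') (FO H x, FO F c)) \<and>
     (\<forall>f\<in>Arr (Under (LMon B)). \<forall>u\<in>Arr (Carrier B).
        FA F (FA (LAct B) (f, u)) = FA (LAct B') (FA H f, FA F u)) \<and>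
     (\<forall>c\<in>Obj (Carrier B). \<forall>y\<in>Obj (Under (RMon B)).
        FO F (FO (RAct B) (c, y)) = FO (RAct B') (FO F c, FO K y)) \<and>
     (\<forall>u\<in>Arr (Carrier B). \<forall>g\<in>Arr (Under (RMon B)).
        FA F (FA (RAct B) (u, g)) = FA (RAct B') (FA F u, FA K g)))"

definition id_bimod_map :: "('o, 'm) bimod \<Rightarrow> ('o, 'm) bimod_map" where
  "id_bimod_map B =
    \<lparr>FMap = id_functor (Carrier B), HMap = id_functor (Under (LMon B)),
     KMap = id_functor (Under (RMon B))\<rparr>"

definition comp_bimod_map ::
    "('o, 'm) bimod \<Rightarrow> ('o, 'm) bimod_map \<Rightarrow> ('o, 'm) bimod_map \<Rightarrow> ('o, 'm) bimod_map" where
  "comp_bimod_map B \<psi> \<phi> =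
    \<lparr>FMap = comp_functor (Carrier B) (FMap \<psi>) (FMap \<phi>),
     HMap = comp_functor (Under (LMon B)) (HMap \<psi>) (HMap \<phi>),
     KMap = comp_functor (Under (RMon B)) (KMap \<psi>) (KMap \<phi>)\<rparr>"

type_synonym ('o, 'm) bimod_arrow = "(('o, 'm) bimod, ('o, 'm) bimod_map) arrow"

definition sBimod :: "(('o, 'm) bimod, ('o, 'm) bimod_arrow) cat" where
  "sBimod = concrete_cat {B. bimodular_category B} (\<lambda>B B'. {\<phi>. bimod_morphism B B' \<phi>})
     id_bimod_map comp_bimod_map"

text \<open>
  A 2-category is presented by its hom-categories, which need not be disjoint: 1-cells and 2-cells
  always come with their boundary 0-cells. \<open>HComp A x y z\<close> is horizontal composition in
  diagrammatic order, from pairs in \<open>A(x,y) \<times> A(y,z)\<close> to \<open>A(x,z)\<close>.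
\<close>

record ('x, 'o, 'm) twocat =
  Cell0 :: "'x set"
  HomCat :: "'x \<Rightarrow> 'x \<Rightarrow> ('o, 'm) cat"
  HComp :: "'x \<Rightarrow> 'x \<Rightarrow> 'x \<Rightarrow> ('o \<times> 'o, 'm \<times> 'm, 'o, 'm) funct"
  Id1 :: "'x \<Rightarrow> 'o"

definition two_category :: "('x, 'o, 'm) twocat \<Rightarrow> bool" where
  "two_category A \<longleftrightarrow>
    (let X = Cell0 A; H = HomCat A; K = HComp A; I = Id1 A in
     (\<forall>x\<in>X. \<forall>y\<in>X. category (H x y)) \<and>
     (\<forall>x\<in>X. \<forall>y\<in>X. \<forall>z\<in>X. is_functor (prod_cat (H x y) (H y z)) (H x z) (K x y z)) \<and>
     (\<forall>x\<in>X. I x \<in> Obj (H x x)) \<and>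
     (\<forall>x\<in>X. \<forall>y\<in>X. \<forall>z\<in>X. \<forall>w\<in>X. \<forall>f\<in>Obj (H x y). \<forall>g\<in>Obj (H y z). \<forall>h\<in>Obj (H z w).
        FO (K x z w) (FO (K x y z) (f, g), h) = FO (K x y w) (f, FO (K y z w) (g, h))) \<and>
     (\<forall>x\<in>X. \<forall>y\<in>X. \<forall>z\<in>X. \<forall>w\<in>X. \<forall>\<alpha>\<in>Arr (H x y). \<forall>\<beta>\<in>Arr (H y z). \<forall>\<gamma>\<in>Arr (H z w).
        FA (K x z w) (FA (K x y z) (\<alpha>, \<beta>), \<gamma>) = FA (K x y w) (\<alpha>, FA (K y z w) (\<beta>, \<gamma>))) \<and>
     (\<forall>x\<in>X. \<forall>y\<in>X. \<forall>f\<in>Obj (H x y).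
        FO (K x x y) (I x, f) = f \<and> FO (K x y y) (f, I y) = f) \<and>
     (\<forall>x\<in>X. \<forall>y\<in>X. \<forall>\<alpha>\<in>Arr (H x y).
        FA (K x x y) (Idn (H x x) (I x), \<alpha>) = \<alpha> \<and> FA (K x y y) (\<alpha>, Idn (H y y) (I y)) = \<alpha>) \<and>
     (\<forall>x y. \<not> (x \<in> X \<and> y \<in> X) \<longrightarrow> H x y = undefined) \<and>
     (\<forall>x y z. \<not> (x \<in> X \<and> y \<in> X \<and> z \<in> X) \<longrightarrow> K x y z = undefined) \<and>
     I \<in> extensional X)"

record ('x, 'o, 'm) two_map =
  Zero :: "'x \<Rightarrow> 'x"
  HomF :: "'x \<Rightarrow> 'x \<Rightarrow> ('o, 'm, 'o, 'm) funct"

definition two_functor ::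
    "('x, 'o, 'm) twocat \<Rightarrow> ('x, 'o, 'm) twocat \<Rightarrow> ('x, 'o, 'm) two_map \<Rightarrow> bool" where
  "two_functor A B T \<longleftrightarrow>
    (let X = Cell0 A; t = Zero T; F = HomF T in
     t \<in> X \<rightarrow>\<^sub>E Cell0 B \<and>
     (\<forall>x\<in>X. \<forall>y\<in>X. is_functor (HomCat A x y) (HomCat B (t x) (t y)) (F x y)) \<and>
     (\<forall>x\<in>X. FO (F x x) (Id1 A x) = Id1 B (t x)) \<and>
     (\<forall>x\<in>X. \<forall>y\<in>X. \<forall>z\<in>X. \<forall>f\<in>Obj (HomCat A x y). \<forall>g\<in>Obj (HomCat A y z).
        FO (F x z) (FO (HComp A x y z) (f, g)) =
        FO (HComp B (t x) (t y) (t z)) (FO (F x y) f, FO (F y z) g)) \<and>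
     (\<forall>x\<in>X. \<forall>y\<in>X. \<forall>z\<in>X. \<forall>\<alpha>\<in>Arr (HomCat A x y). \<forall>\<beta>\<in>Arr (HomCat A y z).
        FA (F x z) (FA (HComp A x y z) (\<alpha>, \<beta>)) =
        FA (HComp B (t x) (t y) (t z)) (FA (F x y) \<alpha>, FA (F y z) \<beta>)) \<and>
     (\<forall>x y. \<not> (x \<in> X \<and> y \<in> X) \<longrightarrow> F x y = undefined))"

definition id_two_map :: "('x, 'o, 'm) twocat \<Rightarrow> ('x, 'o, 'm) two_map" where
  "id_two_map A =
    \<lparr>Zero = (\<lambda>x\<in>Cell0 A. x),
     HomF = (\<lambda>x y. if x \<in> Cell0 A \<and> y \<in> Cell0 A then id_functor (HomCat A x y) else undefined)\<rparr>"

definition comp_two_map ::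
    "('x, 'o, 'm) twocat \<Rightarrow> ('x, 'o, 'm) two_map \<Rightarrow> ('x, 'o, 'm) two_map \<Rightarrow> ('x, 'o, 'm) two_map" where
  "comp_two_map A S T =
    \<lparr>Zero = compose (Cell0 A) (Zero S) (Zero T),
     HomF = (\<lambda>x y. if x \<in> Cell0 A \<and> y \<in> Cell0 A
       then comp_functor (HomCat A x y) (HomF S (Zero T x) (Zero T y)) (HomF T x y)
       else undefined)\<rparr>"

record ('x, 'o, 'm) bipointed =
  TwoCat :: "('x, 'o, 'm) twocat"
  PtM :: 'x
  PtN :: 'x

text \<open>The two chosen 0-cells are allowed to coincide.\<close>

definition bipointed_two_category :: "('x, 'o, 'm) bipointed \<Rightarrow> bool" where
  "bipointed_two_category A \<longleftrightarrow>
     two_category (TwoCat A) \<and> PtM A \<in> Cell0 (TwoCat A) \<and> PtN A \<in> Cell0 (TwoCat A)"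

definition bipointed_two_functor ::
    "('x, 'o, 'm) bipointed \<Rightarrow> ('x, 'o, 'm) bipointed \<Rightarrow> ('x, 'o, 'm) two_map \<Rightarrow> bool" where
  "bipointed_two_functor A B T \<longleftrightarrow>
     two_functor (TwoCat A) (TwoCat B) T \<and> Zero T (PtM A) = PtM B \<and> Zero T (PtN A) = PtN B"

type_synonym ('x, 'o, 'm) bipointed_arrow = "(('x, 'o, 'm) bipointed, ('x, 'o, 'm) two_map) arrow"

definition TwoCat2 :: "(('x, 'o, 'm) bipointed, ('x, 'o, 'm) bipointed_arrow) cat" where
  "TwoCat2 = concrete_cat {A. bipointed_two_category A} (\<lambda>A B. {T. bipointed_two_functor A B T})
     (\<lambda>A. id_two_map (TwoCat A)) (\<lambda>A. comp_two_map (TwoCat A))"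

text \<open>
  The labels \<open>M\<close>, \<open>N\<close> of the two 0-cells of a collage are parameters, meant to be distinct. The
  composites in the branch with \<open>empty_functor\<close> involve the empty category \<open>Coll(N,M)\<close>.
\<close>

definition collage :: "'x \<Rightarrow> 'x \<Rightarrow> ('o, 'm) bimod \<Rightarrow> ('x, 'o, 'm) twocat" where
  "collage M N B =
    \<lparr>Cell0 = {M, N},
     HomCat = (\<lambda>x y.
       if x = M \<and> y = M then Under (LMon B)
       else if x = N \<and> y = N then Under (RMon B)
       else if x = M \<and> y = N then Carrier B
       else if x = N \<and> y = M then empty_cat
       else undefined),
     HComp = (\<lambda>x y z.
       if x = M \<and> y = M \<and> z = M then Tensor (LMon B)
       else if x = N \<and> y = N \<and> z = N then Tensor (RMon B)
       else if x = M \<and> y = M \<and> z = N then LAct B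
       else if x = M \<and> y = N \<and> z = N then RAct B
       else if x \<in> {M, N} \<and> y \<in> {M, N} \<and> z \<in> {M, N} then empty_functor
       else undefined),
     Id1 = (\<lambda>x. if x = M then Unit (LMon B) else if x = N then Unit (RMon B) else undefined)\<rparr>"

definition coll_map :: "'x \<Rightarrow> 'x \<Rightarrow> ('o, 'm) bimod_map \<Rightarrow> ('x, 'o, 'm) two_map" where
  "coll_map M N \<phi> =
    \<lparr>Zero = (\<lambda>x\<in>{M, N}. x),
     HomF = (\<lambda>x y.
       if x = M \<and> y = M then HMap \<phi>
       else if x = N \<and> y = N then KMap \<phi>
       else if x = M \<and> y = N then FMap \<phi>
       else if x = N \<and> y = M then empty_functor
       else undefined)\<rparr>"

definition coll_obj :: "'x \<Rightarrow> 'x \<Rightarrow> ('o, 'm) bimod \<Rightarrow> ('x, 'o, 'm) bipointed" where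
  "coll_obj M N B = \<lparr>TwoCat = collage M N B, PtM = M, PtN = N\<rparr>"

definition Coll ::
    "'x \<Rightarrow> 'x \<Rightarrow> (('o, 'm) bimod, ('o, 'm) bimod_arrow,
                ('x, 'o, 'm) bipointed, ('x, 'o, 'm) bipointed_arrow) funct" where
  "Coll M N =
    \<lparr>FO = restrict (coll_obj M N) (Obj sBimod),
     FA = (\<lambda>f\<in>Arr sBimod.
       Arrow (coll_obj M N (Source f)) (coll_map M N (Map f)) (coll_obj M N (Target f)))\<rparr>"

definition chosen_obj :: "('x, 'o, 'm) bipointed \<Rightarrow> ('o, 'm) bimod" where
  "chosen_obj P =
    (let A = TwoCat P; M = PtM P; N = PtN P in
     \<lparr>Carrier = HomCat A M N,
      LMon = \<lparr>Under = HomCat A M M, Tensor = HComp A M M M, Unit = Id1 A M\<rparr>,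
      RMon = \<lparr>Under = HomCat A N N, Tensor = HComp A N N N, Unit = Id1 A N\<rparr>,
      LAct = HComp A M M N,
      RAct = HComp A M N N\<rparr>)"

definition chosen_map ::
    "('x, 'o, 'm) bipointed \<Rightarrow> ('x, 'o, 'm) two_map \<Rightarrow> ('o, 'm) bimod_map" where
  "chosen_map P T =
    \<lparr>FMap = HomF T (PtM P) (PtN P), HMap = HomF T (PtM P) (PtM P),
     KMap = HomF T (PtN P) (PtN P)\<rparr>"

definition Chosen ::
    "(('x, 'o, 'm) bipointed, ('x, 'o, 'm) bipointed_arrow,
      ('o, 'm) bimod, ('o, 'm) bimod_arrow) funct" where
  "Chosen =
    \<lparr>FO = restrict chosen_obj (Obj TwoCat2),
     FA = (\<lambda>f\<in>Arr TwoCat2.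
       Arrow (chosen_obj (Source f)) (chosen_map (Source f) (Map f)) (chosen_obj (Target f)))\<rparr>"

end

theory Submission
  imports Defs
begin

text \<open>
  The collage keeps the three categories of a bimodular category untouched, so \<open>Chosen \<circ> Coll\<close> is the
  identity functor on the nose and the unit is the identity. The counit at a bipointed 2-category
  \<open>(A, M, N)\<close> is the inclusion of the three hom-categories \<open>A(M,M)\<close>, \<open>A(M,N)\<close>, \<open>A(N,N)\<close>;
  nothing has to be said about \<open>A(N,M)\<close>, since the collage is empty there.
\<close>

section \<open>Categories and functors\<close>

text \<open>Since the unit is an identity, the triangle identities reduce to two facts: the counit
  at a collage is an identity, and \<open>Chosen\<close> sends each counit component to an identity.
  These are strict equalities of HOL terms, so values outside the domains matter: functors and
  2-functors coincide once they agree on their source, and the only functor out of the empty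
  category is \<open>empty_functor\<close>. The labels of the collage must be distinct, since the
  case distinctions in \<open>collage\<close> and \<open>coll_map\<close> would otherwise take the
  first branch for every hom-category. The chosen 0-cells of an arbitrary bipointed 2-category may
  coincide; this does no harm, because the counit branches on the labels of its source and never on
  the 0-cells of its target.\<close>

lemma category_is_functorD:
  assumes "is_functor C D F"
  shows "category C" "category D"
  using assms by (simp_all add: is_functor_def)

lemma category_Idn_in_Arr: "category C \<Longrightarrow> x \<in> Obj C \<Longrightarrow> Idn C x \<in> Arr C"
  by (auto simp: category_def PiE_iff)

lemma category_Dom_Cod:
  assumes "category C" "f \<in> Arr C"
  shows "Dom C f \<in> Obj C" "Cod C f \<in> Obj C"
  using assms by (auto simp: category_def PiE_iff)

lemma category_Dom_Cod_Idn:
  assumes "category C" "x \<in> Obj C"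
  shows "Dom C (Idn C x) = x" "Cod C (Idn C x) = x"
  using assms by (auto simp: category_def)

lemma category_Cmp:
  assumes "category C" "composable C g f"
  shows "Cmp C g f \<in> Arr C" "Dom C (Cmp C g f) = Dom C f" "Cod C (Cmp C g f) = Cod C g"
  using assms by (auto simp: category_def)

lemma category_Cmp_Idn:
  assumes "category C" "f \<in> Arr C"
  shows "Cmp C f (Idn C (Dom C f)) = f" "Cmp C (Idn C (Cod C f)) f = f"
  using assms by (auto simp: category_def)

lemma category_Cmp_assoc:
  assumes "category C" "composable C h g" "composable C g f"
  shows "Cmp C h (Cmp C g f) = Cmp C (Cmp C h g) f"
  using assms by (auto simp: category_def)

lemma category_empty_cat: "category empty_cat"
  by (auto simp: category_def empty_cat_def composable_def)

lemma composable_prod_cat: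
  assumes "category C" "category D"
  shows "composable (prod_cat C D) v u \<longleftrightarrow>
    composable C (fst v) (fst u) \<and> composable D (snd v) (snd u)"
  by (cases v; cases u) (auto simp: composable_def prod_cat_def)

text \<open>\<open>is_functor\<close> includes that its source is a category. A bimodular category
  supplies this for the products on which its tensors and actions live, but not for the products
  with the empty hom-category that occur in a collage.\<close>

lemma category_prod_cat:
  assumes C: "category C" and D: "category D"
  shows "category (prod_cat C D)"
proof -
  note comp = composable_prod_cat[OF C D]
  have sel: "Obj (prod_cat C D) = Obj C \<times> Obj D" "Arr (prod_cat C D) = Arr C \<times> Arr D"
    "\<And>u. u \<in> Arr C \<times> Arr D \<Longrightarrow> Dom (prod_cat C D) u = (Dom C (fst u), Dom D (snd u))"
    "\<And>u. u \<in> Arr C \<times> Arr D \<Longrightarrow> Cod (prod_cat C D) u = (Cod C (fst u), Cod D (snd u))"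
    "\<And>x. x \<in> Obj C \<times> Obj D \<Longrightarrow> Idn (prod_cat C D) x = (Idn C (fst x), Idn D (snd x))"
    "\<And>v u. composable (prod_cat C D) v u \<Longrightarrow>
      Cmp (prod_cat C D) v u = (Cmp C (fst v) (fst u), Cmp D (snd v) (snd u))"
    by (simp_all add: prod_cat_def comp[unfolded prod_cat_def])
  \<comment> \<open>The conditional equations \<open>sel\<close> say nothing off the domains; the
    default values there are read off the raw definition.\<close>
  have undef: "Cmp (prod_cat C D) v u = undefined" if "\<not> composable (prod_cat C D) v u" for v u
    using that unfolding comp by (auto simp: prod_cat_def)
  have ext: "Dom (prod_cat C D) \<in> extensional (Arr C \<times> Arr D)"
    "Cod (prod_cat C D) \<in> extensional (Arr C \<times> Arr D)"
    "Idn (prod_cat C D) \<in> extensional (Obj C \<times> Obj D)"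
    by (simp_all add: prod_cat_def)
  note facts = category_Dom_Cod[OF C] category_Dom_Cod[OF D] category_Idn_in_Arr[OF C]
    category_Idn_in_Arr[OF D] category_Dom_Cod_Idn[OF C] category_Dom_Cod_Idn[OF D]
    category_Cmp[OF C] category_Cmp[OF D] category_Cmp_Idn[OF C] category_Cmp_Idn[OF D]
    category_Cmp_assoc[OF C] category_Cmp_assoc[OF D]
  have closed: "Cmp (prod_cat C D) g f \<in> Arr C \<times> Arr D \<and>
      Dom (prod_cat C D) (Cmp (prod_cat C D) g f) = Dom (prod_cat C D) f \<and>
      Cod (prod_cat C D) (Cmp (prod_cat C D) g f) = Cod (prod_cat C D) g"
    if "composable (prod_cat C D) g f" for g f
  proof -
    have "f \<in> Arr C \<times> Arr D" "g \<in> Arr C \<times> Arr D"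
      using that by (simp_all add: composable_def sel)
    with that show ?thesis by (simp add: sel facts comp)
  qed
  have unit: "Cmp (prod_cat C D) f (Idn (prod_cat C D) (Dom (prod_cat C D) f)) = f \<and>
      Cmp (prod_cat C D) (Idn (prod_cat C D) (Cod (prod_cat C D) f)) f = f"
    if "f \<in> Arr C \<times> Arr D" for f
  proof -
    have "composable (prod_cat C D) f (Idn (prod_cat C D) (Dom (prod_cat C D) f))"
      "composable (prod_cat C D) (Idn (prod_cat C D) (Cod (prod_cat C D) f)) f"
      using that by (auto simp: comp sel facts composable_def)
    with that show ?thesis by (cases f) (simp add: sel facts)
  qed
  have assoc: "Cmp (prod_cat C D) h (Cmp (prod_cat C D) g f) =
      Cmp (prod_cat C D) (Cmp (prod_cat C D) h g) f"
    if hg: "composable (prod_cat C D) h g" and gf: "composable (prod_cat C D) g f" for h g f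
  proof -
    \<comment> \<open>The outer composites unfold to pairs only once they are known to be
      composable; after that associativity holds componentwise.\<close>
    have "composable (prod_cat C D) h (Cmp (prod_cat C D) g f)"
      "composable (prod_cat C D) (Cmp (prod_cat C D) h g) f"
      using hg gf closed[OF hg] closed[OF gf] by (simp_all add: composable_def sel(2))
    with hg gf show ?thesis by (simp add: sel(6)) (simp add: comp facts)
  qed
  show ?thesis
    unfolding category_def
    using ext closed unit assoc undef
    by (simp add: sel(1,2) PiE_iff) (auto simp: sel facts)
qed

section \<open>Functors, their composition and their equality\<close>

lemma is_functor_Idn:
  "is_functor C D F \<Longrightarrow> x \<in> Obj C \<Longrightarrow> FA F (Idn C x) = Idn D (FO F x)"
  by (simp add: is_functor_def)

lemma is_functor_FO: "is_functor C D F \<Longrightarrow> x \<in> Obj C \<Longrightarrow> FO F x \<in> Obj D"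
  and is_functor_FA: "is_functor C D F \<Longrightarrow> f \<in> Arr C \<Longrightarrow> FA F f \<in> Arr D"
  by (auto simp: is_functor_def PiE_iff)

lemma composable_is_functor:
  "is_functor C D F \<Longrightarrow> composable C g f \<Longrightarrow> composable D (FA F g) (FA F f)"
  by (auto simp: is_functor_def composable_def PiE_iff)

lemma functor_prod_catD:
  assumes "is_functor (prod_cat C D) E F"
  shows "x \<in> Obj C \<Longrightarrow> y \<in> Obj D \<Longrightarrow> FO F (x, y) \<in> Obj E"
    and "f \<in> Arr C \<Longrightarrow> g \<in> Arr D \<Longrightarrow> FA F (f, g) \<in> Arr E"
  using is_functor_FO[OF assms] is_functor_FA[OF assms] by (simp_all add: prod_cat_def)

lemma id_functor_simps [simp]:
  "x \<in> Obj C \<Longrightarrow> FO (id_functor C) x = x" "f \<in> Arr C \<Longrightarrow> FA (id_functor C) f = f"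
  by (simp_all add: id_functor_def)

lemma comp_functor_simps [simp]:
  "x \<in> Obj C \<Longrightarrow> FO (comp_functor C G F) x = FO G (FO F x)"
  "f \<in> Arr C \<Longrightarrow> FA (comp_functor C G F) f = FA G (FA F f)"
  by (simp_all add: comp_functor_def compose_def)

lemma is_functor_id_functor: "category C \<Longrightarrow> is_functor C C (id_functor C)"
  by (auto simp: is_functor_def category_Dom_Cod category_Idn_in_Arr category_Cmp
      composable_def id_functor_def)

lemma is_functor_comp_functor:
  assumes F: "is_functor C D F" and G: "is_functor D E G"
  shows "is_functor C E (comp_functor C G F)"
proof -
  have C: "category C" and E: "category E"
    using F G by (simp_all add: is_functor_def)
  have ext: "FO (comp_functor C G F) \<in> extensional (Obj C)"
    "FA (comp_functor C G F) \<in> extensional (Arr C)"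
    by (simp_all add: comp_functor_def)
  have arr: "composable C g f \<Longrightarrow> g \<in> Arr C \<and> f \<in> Arr C \<and> Cmp C g f \<in> Arr C" for g f
    using category_Cmp[OF C] by (simp add: composable_def)
  have "FA (comp_functor C G F) (Cmp C g f) =
      Cmp E (FA (comp_functor C G F) g) (FA (comp_functor C G F) f)"
    if "composable C g f" for g f
    using that F G composable_is_functor[OF F that] arr[OF that] by (simp add: is_functor_def)
  moreover have "Dom E (FA G (FA F f)) = FO G (FO F (Dom C f)) \<and>
      Cod E (FA G (FA F f)) = FO G (FO F (Cod C f))" if "f \<in> Arr C" for f
    using that F G is_functor_FA[OF F that] by (simp add: is_functor_def)
  ultimately show ?thesis
    using C E ext unfolding is_functor_def
    by (auto simp: PiE_iff category_Dom_Cod category_Idn_in_Arr is_functor_FO[OF F]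
        is_functor_FA[OF F] is_functor_FO[OF G] is_functor_FA[OF G] is_functor_Idn[OF F]
        is_functor_Idn[OF G])
qed

text \<open>Extensionality refers to the source only, so the two targets may be different
  categories.\<close>

lemma funct_eqI:
  assumes "is_functor C D F" "is_functor C D' G"
    and "\<And>x. x \<in> Obj C \<Longrightarrow> FO F x = FO G x" "\<And>f. f \<in> Arr C \<Longrightarrow> FA F f = FA G f"
  shows "F = G"
proof -
  have "FO F = FO G" "FA F = FA G"
    using assms by (auto simp: is_functor_def PiE_iff intro!: extensionalityI)
  then show ?thesis by simp
qed

lemma comp_functor_id_functor:
  assumes "is_functor C D F"
  shows "comp_functor C F (id_functor C) = F" "comp_functor C (id_functor D) F = F"
  using is_functor_comp_functor[OF is_functor_id_functor assms]
    is_functor_comp_functor[OF assms is_functor_id_functor] assms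
  by (auto intro!: funct_eqI simp: category_is_functorD[OF assms] is_functor_FO[OF assms]
      is_functor_FA[OF assms])

lemma comp_functor_assoc:
  assumes F: "is_functor C D F" and G: "is_functor D E G" and H: "is_functor E E' H"
  shows "comp_functor C H (comp_functor C G F) = comp_functor C (comp_functor D H G) F"
  using is_functor_comp_functor[OF is_functor_comp_functor[OF F G] H]
    is_functor_comp_functor[OF F is_functor_comp_functor[OF G H]]
  by (rule funct_eqI) (simp_all add: is_functor_FO[OF F] is_functor_FA[OF F])

text \<open>The domain of an arrow would be an object, so there are no arrows either and every
  condition is vacuous. The assumption is on \<open>Obj C\<close>, rather than \<open>C\<close>
  being \<open>empty_cat\<close>, so that products with an empty factor are covered.\<close>

lemma is_functor_empty_functor:
  assumes "category C" "category D" "Obj C = {}"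
  shows "is_functor C D empty_functor"
proof -
  have "Arr C = {}"
    using assms category_Dom_Cod by fastforce
  then show ?thesis
    using assms by (auto simp: is_functor_def empty_functor_def composable_def)
qed

text \<open>A composite restricted to the empty set is undefined everywhere, whatever
  \<open>G\<close> and \<open>F\<close> are. This settles the component at Coll(N,M) in equations
  between composites of 2-functors out of a collage.\<close>

lemma comp_functor_empty_cat: "comp_functor empty_cat G F = empty_functor"
  by (auto simp: comp_functor_def empty_cat_def empty_functor_def compose_def)

section \<open>Concrete categories\<close>

lemma concrete_cat_simps:
  "Obj (concrete_cat S hom idn cmp) = S"
  "Arrow x f y \<in> Arr (concrete_cat S hom idn cmp) \<longleftrightarrow> x \<in> S \<and> y \<in> S \<and> f \<in> hom x y"
  "a \<in> Arr (concrete_cat S hom idn cmp) \<Longrightarrow> Dom (concrete_cat S hom idn cmp) a = Source a"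
  "a \<in> Arr (concrete_cat S hom idn cmp) \<Longrightarrow> Cod (concrete_cat S hom idn cmp) a = Target a"
  "x \<in> S \<Longrightarrow> Idn (concrete_cat S hom idn cmp) x = Arrow x (idn x) x"
  "Cmp (concrete_cat S hom idn cmp) b a =
    (if composable (concrete_cat S hom idn cmp) b a
     then Arrow (Source a) (cmp (Source a) (Map b) (Map a)) (Target b) else undefined)"
  "composable (concrete_cat S hom idn cmp) b a \<longleftrightarrow>
    b \<in> Arr (concrete_cat S hom idn cmp) \<and> a \<in> Arr (concrete_cat S hom idn cmp) \<and>
    Source b = Target a"
  by (auto simp: concrete_cat_def composable_def Let_def)

lemma concrete_cat_ArrE:
  assumes "a \<in> Arr (concrete_cat S hom idn cmp)"
  obtains x f y where "a = Arrow x f y" "x \<in> S" "y \<in> S" "f \<in> hom x y"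
  using assms by (cases a) (auto simp: concrete_cat_simps)

text \<open>Arrows carry their boundaries, so domains and codomains of composites are automatic and
  only laws about the underlying maps remain. In \<open>assoc\<close> the inner composite on the
  right is formed over \<open>y\<close>, the source of \<open>g\<close>, because \<open>cmp\<close>
  restricts to the source of its last argument.\<close>

lemma category_concrete_cat:
  assumes idn: "\<And>x. x \<in> S \<Longrightarrow> idn x \<in> hom x x"
    and cmp: "\<And>x y z f g. \<lbrakk>x \<in> S; y \<in> S; z \<in> S; f \<in> hom x y; g \<in> hom y z\<rbrakk> \<Longrightarrow>
      cmp x g f \<in> hom x z"
    and unit: "\<And>x y f. \<lbrakk>x \<in> S; y \<in> S; f \<in> hom x y\<rbrakk> \<Longrightarrow> cmp x f (idn x) = f"
      "\<And>x y f. \<lbrakk>x \<in> S; y \<in> S; f \<in> hom x y\<rbrakk> \<Longrightarrow> cmp x (idn y) f = f"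
    and assoc: "\<And>x y z w f g h. \<lbrakk>x \<in> S; y \<in> S; z \<in> S; w \<in> S; f \<in> hom x y; g \<in> hom y z;
      h \<in> hom z w\<rbrakk> \<Longrightarrow> cmp x h (cmp x g f) = cmp x (cmp y h g) f"
  shows "category (concrete_cat S hom idn cmp)" (is "category ?C")
proof -
  note [simp] = concrete_cat_simps
  have ext: "Dom ?C \<in> extensional (Arr ?C)" "Cod ?C \<in> extensional (Arr ?C)"
    "Idn ?C \<in> extensional S"
    by (simp_all add: concrete_cat_def Let_def)
  have "Dom ?C \<in> Arr ?C \<rightarrow>\<^sub>E S" "Cod ?C \<in> Arr ?C \<rightarrow>\<^sub>E S" "Idn ?C \<in> S \<rightarrow>\<^sub>E Arr ?C"
    using ext idn by (auto simp: PiE_iff elim: concrete_cat_ArrE)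
  moreover have "Dom ?C (Idn ?C x) = x \<and> Cod ?C (Idn ?C x) = x" if "x \<in> S" for x
    using that idn by simp
  moreover have "Cmp ?C g f \<in> Arr ?C \<and> Dom ?C (Cmp ?C g f) = Dom ?C f \<and>
      Cod ?C (Cmp ?C g f) = Cod ?C g" if "composable ?C g f" for g f
    using that cmp by (auto elim!: concrete_cat_ArrE)
  moreover have "Cmp ?C f (Idn ?C (Dom ?C f)) = f \<and> Cmp ?C (Idn ?C (Cod ?C f)) f = f"
    if "f \<in> Arr ?C" for f
    using that idn by (auto elim!: concrete_cat_ArrE simp: unit)
  moreover have "Cmp ?C h (Cmp ?C g f) = Cmp ?C (Cmp ?C h g) f"
    if "composable ?C h g" "composable ?C g f" for h g f
    using that cmp by (auto elim!: concrete_cat_ArrE simp: assoc)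
  moreover have "Obj ?C = S" "\<not> composable ?C g f \<Longrightarrow> Cmp ?C g f = undefined" for g f
    by auto
  ultimately show ?thesis
    unfolding category_def by (simp del: concrete_cat_simps)
qed

text \<open>The map part \<open>G\<close> receives the source object because
  \<open>chosen_map\<close> must know the chosen 0-cells of the source. The shape of the functor
  matches the definitions of \<open>Coll\<close> and \<open>Chosen\<close>.\<close>

lemma is_functor_concrete_cat:
  fixes S hom idn cmp
  defines "C \<equiv> concrete_cat S hom idn cmp"
  assumes C: "category C" and D: "category (concrete_cat S' hom' idn' cmp')"
    and F: "\<And>x. x \<in> S \<Longrightarrow> F x \<in> S'"
    and G: "\<And>x y f. \<lbrakk>x \<in> S; y \<in> S; f \<in> hom x y\<rbrakk> \<Longrightarrow> G x f \<in> hom' (F x) (F y)"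
    and idn: "\<And>x. x \<in> S \<Longrightarrow> G x (idn x) = idn' (F x)"
    and cmp: "\<And>x y z f g. \<lbrakk>x \<in> S; y \<in> S; z \<in> S; f \<in> hom x y; g \<in> hom y z\<rbrakk> \<Longrightarrow>
      G x (cmp x g f) = cmp' (F x) (G y g) (G x f)"
  shows "is_functor C (concrete_cat S' hom' idn' cmp')
    \<lparr>FO = restrict F (Obj C),
     FA = (\<lambda>a\<in>Arr C. Arrow (F (Source a)) (G (Source a) (Map a)) (F (Target a)))\<rparr>"
    (is "is_functor C ?D ?F")
proof -
  note [simp] = concrete_cat_simps
  have O: "Obj C = S"
    by (simp add: C_def)
  have idnC: "Idn C x \<in> Arr C" if "x \<in> S" for x
    using that category_Idn_in_Arr[OF C] O by simp
  have A: "FA ?F a \<in> Arr ?D \<and> Dom ?D (FA ?F a) = F (Dom C a) \<and> Cod ?D (FA ?F a) = F (Cod C a)"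
    if "a \<in> Arr C" for a
    using that F G by (auto simp: C_def elim!: concrete_cat_ArrE)
  have "FA ?F (Idn C x) = Idn ?D (F x)" if "x \<in> S" for x
    using that idnC[OF that] F idn by (simp add: C_def)
  moreover have "FA ?F (Cmp C g f) = Cmp ?D (FA ?F g) (FA ?F f)" if "composable C g f" for g f
  proof -
    have "g \<in> Arr C" "f \<in> Arr C" "Cmp C g f \<in> Arr C"
      using that category_Cmp[OF C that] by (simp_all add: composable_def)
    then show ?thesis
      using that F G cmp by (auto simp: C_def elim!: concrete_cat_ArrE)
  qed
  moreover have "Dom C a = Source a \<and> Cod C a = Target a \<and> Source a \<in> S \<and> Target a \<in> S"
    if "a \<in> Arr C" for a
    using that by (auto simp: C_def elim!: concrete_cat_ArrE)
  ultimately show ?thesis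
    using C D A F unfolding is_functor_def by (simp add: O PiE_iff)
qed

section \<open>Bimodular categories\<close>

lemma bimodular_categoryD:
  assumes "bimodular_category B"
  shows "category (Carrier B)" "category (Under (LMon B))" "category (Under (RMon B))"
    and "is_functor (prod_cat (Under (LMon B)) (Under (LMon B))) (Under (LMon B)) (Tensor (LMon B))"
    and "is_functor (prod_cat (Under (RMon B)) (Under (RMon B))) (Under (RMon B)) (Tensor (RMon B))"
    and "is_functor (prod_cat (Under (LMon B)) (Carrier B)) (Carrier B) (LAct B)"
    and "is_functor (prod_cat (Carrier B) (Under (RMon B))) (Carrier B) (RAct B)"
    and "Unit (LMon B) \<in> Obj (Under (LMon B))" "Unit (RMon B) \<in> Obj (Under (RMon B))"
  using assms
  by (auto simp: bimodular_category_def monoidal_category_def left_action_def right_action_def Let_def)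

lemma bimod_morphismD:
  assumes "bimod_morphism B B' \<phi>"
  shows "is_functor (Carrier B) (Carrier B') (FMap \<phi>)"
    and "is_functor (Under (LMon B)) (Under (LMon B')) (HMap \<phi>)"
    and "is_functor (Under (RMon B)) (Under (RMon B')) (KMap \<phi>)"
  using assms by (simp_all add: bimod_morphism_def monoidal_functor_def Let_def)

lemma bimod_morphism_id_bimod_map:
  assumes "bimodular_category B"
  shows "bimod_morphism B B (id_bimod_map B)"
proof -
  note B = bimodular_categoryD[OF assms]
  \<comment> \<open>An identity functor returns its argument only inside its category, so the values
    of the tensors and actions must be known to lie there.\<close>
  note [simp] = functor_prod_catD[OF B(4)] functor_prod_catD[OF B(5)]
    functor_prod_catD[OF B(6)] functor_prod_catD[OF B(7)]
  show ?thesis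
    by (simp add: bimod_morphism_def monoidal_functor_def id_bimod_map_def Let_def
        is_functor_id_functor B)
qed

lemma bimod_morphism_comp_bimod_map:
  assumes B: "bimodular_category B"
    and \<phi>: "bimod_morphism B B' \<phi>" and \<psi>: "bimod_morphism B' B'' \<psi>"
  shows "bimod_morphism B B'' (comp_bimod_map B \<psi> \<phi>)"
proof -
  note B = bimodular_categoryD[OF B]
  note F = bimod_morphismD[OF \<phi>] and G = bimod_morphismD[OF \<psi>]
  note [simp] = functor_prod_catD[OF B(4)] functor_prod_catD[OF B(5)]
    functor_prod_catD[OF B(6)] functor_prod_catD[OF B(7)]
    is_functor_FO[OF F(1)] is_functor_FO[OF F(2)] is_functor_FO[OF F(3)]
    is_functor_FA[OF F(1)] is_functor_FA[OF F(2)] is_functor_FA[OF F(3)]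
  show ?thesis
    using \<phi> \<psi> B(8,9) is_functor_comp_functor[OF F(1) G(1)] is_functor_comp_functor[OF F(2) G(2)]
      is_functor_comp_functor[OF F(3) G(3)]
    by (simp add: bimod_morphism_def monoidal_functor_def comp_bimod_map_def Let_def)
qed

lemma category_sBimod: "category sBimod"
  unfolding sBimod_def
proof (rule category_concrete_cat)
  fix B B' :: "('o, 'm) bimod" and \<phi>
  assume "\<phi> \<in> {\<phi>. bimod_morphism B B' \<phi>}"
  then have \<phi>: "bimod_morphism B B' \<phi>" by simp
  note F = bimod_morphismD[OF \<phi>]
  show "comp_bimod_map B \<phi> (id_bimod_map B) = \<phi>" "comp_bimod_map B (id_bimod_map B') \<phi> = \<phi>"
    by (simp_all add: comp_bimod_map_def id_bimod_map_def comp_functor_id_functor[OF F(1)]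
        comp_functor_id_functor[OF F(2)] comp_functor_id_functor[OF F(3)])
next
  fix B B' B'' C :: "('o, 'm) bimod" and \<phi> \<psi> \<chi>
  assume "\<phi> \<in> {\<phi>. bimod_morphism B B' \<phi>}" "\<psi> \<in> {\<psi>. bimod_morphism B' B'' \<psi>}"
    "\<chi> \<in> {\<chi>. bimod_morphism B'' C \<chi>}"
  then have "bimod_morphism B B' \<phi>" "bimod_morphism B' B'' \<psi>" "bimod_morphism B'' C \<chi>"
    by simp_all
  then show "comp_bimod_map B \<chi> (comp_bimod_map B \<psi> \<phi>) =
      comp_bimod_map B (comp_bimod_map B' \<chi> \<psi>) \<phi>"
    by (auto simp: comp_bimod_map_def intro!: comp_functor_assoc dest: bimod_morphismD)
qed (auto intro: bimod_morphism_id_bimod_map bimod_morphism_comp_bimod_map)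

section \<open>Bipointed 2-categories\<close>

lemma two_categoryD:
  assumes "two_category A"
  shows "x \<in> Cell0 A \<Longrightarrow> y \<in> Cell0 A \<Longrightarrow> category (HomCat A x y)"
    and "x \<in> Cell0 A \<Longrightarrow> y \<in> Cell0 A \<Longrightarrow> z \<in> Cell0 A \<Longrightarrow>
      is_functor (prod_cat (HomCat A x y) (HomCat A y z)) (HomCat A x z) (HComp A x y z)"
    and "x \<in> Cell0 A \<Longrightarrow> Id1 A x \<in> Obj (HomCat A x x)"
  using assms by (simp_all add: two_category_def Let_def)

lemma two_functorD:
  assumes "two_functor A B T"
  shows "x \<in> Cell0 A \<Longrightarrow> Zero T x \<in> Cell0 B"
    and "x \<in> Cell0 A \<Longrightarrow> y \<in> Cell0 A \<Longrightarrow>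
      is_functor (HomCat A x y) (HomCat B (Zero T x) (Zero T y)) (HomF T x y)"
  using assms by (auto simp: two_functor_def Let_def)

text \<open>Outside \<open>Cell0 A\<close> both maps are undefined on 0-cells, and both families of
  hom-functors are undefined whenever one index is not a 0-cell.\<close>

lemma two_map_eqI:
  assumes "two_functor A B S" "two_functor A B' T"
    and "\<And>x. x \<in> Cell0 A \<Longrightarrow> Zero S x = Zero T x"
    and "\<And>x y. x \<in> Cell0 A \<Longrightarrow> y \<in> Cell0 A \<Longrightarrow> HomF S x y = HomF T x y"
  shows "S = T"
proof -
  have "Zero S = Zero T"
    using assms by (auto simp: two_functor_def Let_def PiE_iff intro!: extensionalityI)
  moreover have "HomF S = HomF T"
  proof (intro ext)
    fix x y
    show "HomF S x y = HomF T x y"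
      using assms by (cases "x \<in> Cell0 A \<and> y \<in> Cell0 A") (auto simp: two_functor_def Let_def)
  qed
  ultimately show ?thesis by simp
qed

lemma two_functor_id_two_map:
  assumes "two_category A"
  shows "two_functor A A (id_two_map A)"
  using functor_prod_catD[OF two_categoryD(2)[OF assms]] two_categoryD[OF assms]
  by (simp add: two_functor_def id_two_map_def Let_def is_functor_id_functor)

lemma comp_two_map_simps:
  "x \<in> Cell0 A \<Longrightarrow> Zero (comp_two_map A S T) x = Zero S (Zero T x)"
  "x \<in> Cell0 A \<Longrightarrow> y \<in> Cell0 A \<Longrightarrow> HomF (comp_two_map A S T) x y =
    comp_functor (HomCat A x y) (HomF S (Zero T x) (Zero T y)) (HomF T x y)"
  by (simp_all add: comp_two_map_def compose_def)

lemma two_functor_comp_two_map: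
  assumes A: "two_category A" and T: "two_functor A B T" and S: "two_functor B C S"
  shows "two_functor A C (comp_two_map A S T)"
proof -
  note T' = two_functorD[OF T] and S' = two_functorD[OF S]
  note [simp] = functor_prod_catD[OF two_categoryD(2)[OF A]] two_categoryD(3)[OF A]
    T' is_functor_FO[OF T'(2)] is_functor_FA[OF T'(2)] comp_two_map_simps
  have "Zero (comp_two_map A S T) \<in> Cell0 A \<rightarrow>\<^sub>E Cell0 C"
    using S' by (auto simp: PiE_iff) (simp add: comp_two_map_def)
  moreover have "HomF (comp_two_map A S T) x y = undefined"
    if "\<not> (x \<in> Cell0 A \<and> y \<in> Cell0 A)" for x y
    using that by (auto simp: comp_two_map_def)
  moreover have "is_functor (HomCat A x y) (HomCat C (Zero S (Zero T x)) (Zero S (Zero T y)))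
      (HomF (comp_two_map A S T) x y)" if "x \<in> Cell0 A" "y \<in> Cell0 A" for x y
    using that is_functor_comp_functor[OF T'(2) S'(2)] by simp
  ultimately show ?thesis
    using T S unfolding two_functor_def Let_def by simp
qed

lemma bipointed_two_functor_comp_two_map:
  assumes "bipointed_two_category P" "bipointed_two_functor P Q T" "bipointed_two_functor Q R S"
  shows "bipointed_two_functor P R (comp_two_map (TwoCat P) S T)"
  using assms unfolding bipointed_two_category_def bipointed_two_functor_def
  by (auto simp: comp_two_map_simps intro: two_functor_comp_two_map)

lemma bipointed_two_functor_id_two_map:
  assumes "bipointed_two_category P"
  shows "bipointed_two_functor P P (id_two_map (TwoCat P))"
  using assms unfolding bipointed_two_category_def bipointed_two_functor_def
  by (simp add: two_functor_id_two_map) (simp add: id_two_map_def)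

lemma comp_two_map_id_two_map:
  assumes A: "two_category A" and B: "two_category B" and T: "two_functor A B T"
  shows "comp_two_map A T (id_two_map A) = T" "comp_two_map A (id_two_map B) T = T"
proof -
  note [simp] = comp_two_map_simps comp_functor_id_functor[OF two_functorD(2)[OF T]]
    two_functorD[OF T]
  show "comp_two_map A T (id_two_map A) = T"
    by (rule two_map_eqI[OF two_functor_comp_two_map[OF A two_functor_id_two_map[OF A] T] T])
      (simp_all add: id_two_map_def)
  show "comp_two_map A (id_two_map B) T = T"
    by (rule two_map_eqI[OF two_functor_comp_two_map[OF A T two_functor_id_two_map[OF B]] T])
      (simp_all add: id_two_map_def)
qed

lemma comp_two_map_assoc:
  assumes A: "two_category A" and B: "two_category B"
    and T: "two_functor A B T" and S: "two_functor B C S" and R: "two_functor C D R"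
  shows "comp_two_map A R (comp_two_map A S T) = comp_two_map A (comp_two_map B R S) T"
proof (rule two_map_eqI)
  show "two_functor A D (comp_two_map A R (comp_two_map A S T))"
    by (rule two_functor_comp_two_map[OF A two_functor_comp_two_map[OF A T S] R])
  show "two_functor A D (comp_two_map A (comp_two_map B R S) T)"
    by (rule two_functor_comp_two_map[OF A T two_functor_comp_two_map[OF B S R]])
next
  fix x y assume "x \<in> Cell0 A" "y \<in> Cell0 A"
  then show "HomF (comp_two_map A R (comp_two_map A S T)) x y =
      HomF (comp_two_map A (comp_two_map B R S) T) x y"
    using two_functorD[OF T] two_functorD[OF S] two_functorD[OF R]
    by (simp add: comp_two_map_simps comp_functor_assoc[OF two_functorD(2)[OF T]
        two_functorD(2)[OF S] two_functorD(2)[OF R]])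
qed (simp add: comp_two_map_simps two_functorD[OF T])

lemma category_TwoCat2: "category TwoCat2"
  unfolding TwoCat2_def
proof (rule category_concrete_cat)
  fix P Q R S :: "('x, 'o, 'm) bipointed" and T U V
  assume "P \<in> {P. bipointed_two_category P}" "Q \<in> {P. bipointed_two_category P}"
    and "T \<in> {T. bipointed_two_functor P Q T}" "U \<in> {T. bipointed_two_functor Q R T}"
      "V \<in> {T. bipointed_two_functor R S T}"
  then show "comp_two_map (TwoCat P) V (comp_two_map (TwoCat P) U T) =
      comp_two_map (TwoCat P) (comp_two_map (TwoCat Q) V U) T"
    by (auto simp: bipointed_two_category_def bipointed_two_functor_def intro: comp_two_map_assoc)
next
  fix P Q :: "('x, 'o, 'm) bipointed" and T
  assume "P \<in> {P. bipointed_two_category P}" "Q \<in> {P. bipointed_two_category P}"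
    "T \<in> {T. bipointed_two_functor P Q T}"
  then show "comp_two_map (TwoCat P) T (id_two_map (TwoCat P)) = T"
      "comp_two_map (TwoCat P) (id_two_map (TwoCat Q)) T = T"
    by (auto simp: bipointed_two_category_def bipointed_two_functor_def
        intro: comp_two_map_id_two_map)
qed (auto intro: bipointed_two_functor_id_two_map bipointed_two_functor_comp_two_map)

section \<open>The adjunction\<close>

lemma sBimod_simps:
  "Obj sBimod = {B. bimodular_category B}"
  "Arrow B \<phi> B' \<in> Arr sBimod \<longleftrightarrow>
    bimodular_category B \<and> bimodular_category B' \<and> bimod_morphism B B' \<phi>"
  "f \<in> Arr sBimod \<Longrightarrow> Dom sBimod f = Source f" "f \<in> Arr sBimod \<Longrightarrow> Cod sBimod f = Target f"
  "bimodular_category B \<Longrightarrow> Idn sBimod B = Arrow B (id_bimod_map B) B"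
  by (auto simp: sBimod_def concrete_cat_simps)

lemma TwoCat2_simps:
  "Obj TwoCat2 = {P. bipointed_two_category P}"
  "Arrow P T Q \<in> Arr TwoCat2 \<longleftrightarrow>
    bipointed_two_category P \<and> bipointed_two_category Q \<and> bipointed_two_functor P Q T"
  "f \<in> Arr TwoCat2 \<Longrightarrow> Dom TwoCat2 f = Source f" "f \<in> Arr TwoCat2 \<Longrightarrow> Cod TwoCat2 f = Target f"
  "bipointed_two_category P \<Longrightarrow> Idn TwoCat2 P = Arrow P (id_two_map (TwoCat P)) P"
  by (auto simp: TwoCat2_def concrete_cat_simps)

lemma TwoCat2_Cmp:
  assumes "Arrow P T Q \<in> Arr TwoCat2" "Arrow Q S R \<in> Arr TwoCat2"
  shows "Cmp TwoCat2 (Arrow Q S R) (Arrow P T Q) = Arrow P (comp_two_map (TwoCat P) S T) R"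
  using assms by (auto simp: TwoCat2_def concrete_cat_simps)

section \<open>The collage and its functoriality\<close>

lemma Obj_Arr_empty_cat: "Obj empty_cat = {}" "Arr empty_cat = {}"
  by (simp_all add: empty_cat_def)

text \<open>A path of four 0-cells that never steps from N to M is one of five. MMMM and NNNN give
  associativity of the two tensors, MMMN and MNNN the laws of the left and right action, and MMNN
  their compatibility. Every other path passes through the empty category, where the axioms are
  vacuous.\<close>

lemma two_category_collage:
  fixes B :: "('o, 'm) bimod"
  assumes MN: "M \<noteq> N" and B: "bimodular_category B"
  shows "two_category (collage M N B)"
proof -
  note D = bimodular_categoryD[OF B]
  \<comment> \<open>This covers the composition functors of the collage in which one factor is
    Coll(N,M).\<close>
  have "is_functor (prod_cat C D) E empty_functor"
    if "category C" "category D" "category E" "Obj C = {} \<or> Obj D = {}"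
    for C D E :: "('o, 'm) cat"
    using that by (intro is_functor_empty_functor category_prod_cat) (auto simp: prod_cat_def)
  then show ?thesis
    using B MN D unfolding bimodular_category_def two_category_def Let_def
    by (simp add: collage_def Obj_Arr_empty_cat category_empty_cat extensional_def
        monoidal_category_def left_action_def right_action_def Let_def)
qed

lemma TwoCat_coll_obj: "TwoCat (coll_obj M N B) = collage M N B"
  by (simp add: coll_obj_def)

lemma bipointed_two_category_coll_obj:
  assumes "M \<noteq> N" "bimodular_category B"
  shows "bipointed_two_category (coll_obj M N B)"
  using two_category_collage[OF assms]
  by (simp add: bipointed_two_category_def coll_obj_def) (simp add: collage_def)

text \<open>Preservation of composition along MMM and NNN is monoidality of H and K, and along MMN
  and MNN it is preservation of the actions; the remaining triples involve the empty
  category.\<close>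

lemma bipointed_two_functor_coll_map:
  assumes MN: "M \<noteq> N" and \<phi>: "bimod_morphism B B' \<phi>"
  shows "bipointed_two_functor (coll_obj M N B) (coll_obj M N B') (coll_map M N \<phi>)"
  using MN \<phi> is_functor_empty_functor[OF category_empty_cat category_empty_cat]
  unfolding bipointed_two_functor_def two_functor_def bimod_morphism_def monoidal_functor_def Let_def
  by (simp add: coll_obj_def collage_def coll_map_def Obj_Arr_empty_cat)

text \<open>At Coll(N,M) the two sides agree because the identity functor, restricted to no objects
  and no arrows, is \<open>empty_functor\<close>.\<close>

lemma coll_map_id_bimod_map:
  "M \<noteq> N \<Longrightarrow> coll_map M N (id_bimod_map B) = id_two_map (collage M N B)"
  by (auto simp: coll_map_def id_two_map_def collage_def id_bimod_map_def id_functor_def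
      empty_functor_def empty_cat_def fun_eq_iff)

lemma coll_map_comp_bimod_map:
  "M \<noteq> N \<Longrightarrow> coll_map M N (comp_bimod_map B \<psi> \<phi>) =
    comp_two_map (collage M N B) (coll_map M N \<psi>) (coll_map M N \<phi>)"
  by (auto simp: coll_map_def comp_two_map_def collage_def comp_bimod_map_def
      comp_functor_empty_cat compose_def fun_eq_iff)

lemma is_functor_Coll:
  fixes M N :: 'x
  assumes MN: "M \<noteq> N"
  shows "is_functor (sBimod :: (('o, 'm) bimod, _) cat) TwoCat2 (Coll M N)"
  unfolding Coll_def sBimod_def TwoCat2_def
  by (rule is_functor_concrete_cat[where G = "\<lambda>_. coll_map M N"])
    (auto simp: category_sBimod[unfolded sBimod_def] category_TwoCat2[unfolded TwoCat2_def]
      bipointed_two_category_coll_obj[OF MN] bipointed_two_functor_coll_map[OF MN]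
      coll_map_id_bimod_map[OF MN] coll_map_comp_bimod_map[OF MN] TwoCat_coll_obj)

section \<open>The hom-category between the chosen 0-cells\<close>

lemma bimodular_category_chosen_obj:
  assumes "bipointed_two_category P"
  shows "bimodular_category (chosen_obj P)"
  \<comment> \<open>The axioms of a 2-category are specialised to the chosen 0-cells; associativity
    along M, M, N, N is the compatibility of the two actions.\<close>
  using assms
  unfolding bipointed_two_category_def two_category_def bimodular_category_def Let_def
    monoidal_category_def left_action_def right_action_def chosen_obj_def
  by simp

lemma bimod_morphism_chosen_map:
  assumes "bipointed_two_category P" "bipointed_two_functor P Q T"
  shows "bimod_morphism (chosen_obj P) (chosen_obj Q) (chosen_map P T)"
proof -
  have "is_functor (HomCat (TwoCat P) x y) (HomCat (TwoCat Q) (Zero T x) (Zero T y)) (HomF T x y)"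
    if "x \<in> {PtM P, PtN P}" "y \<in> {PtM P, PtN P}" for x y
    using assms that unfolding bipointed_two_category_def bipointed_two_functor_def
    by (auto intro: two_functorD)
  from this[of "PtM P" "PtM P"] this[of "PtM P" "PtN P"] this[of "PtN P" "PtN P"]
  show ?thesis
    using assms
    unfolding bipointed_two_category_def bipointed_two_functor_def two_functor_def Let_def
      bimod_morphism_def monoidal_functor_def chosen_obj_def chosen_map_def
    by simp
qed

lemma is_functor_Chosen:
  "is_functor TwoCat2 (sBimod :: (('o, 'm) bimod, _) cat)
    (Chosen :: (('x, 'o, 'm) bipointed, _, _, _) funct)"
  unfolding Chosen_def sBimod_def TwoCat2_def
proof (rule is_functor_concrete_cat, goal_cases)
  \<comment> \<open>Goals 5 and 6 are preservation of identities and of composites. In the latter,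
    \<open>T\<close> preserves the chosen 0-cells, so \<open>S\<close> is evaluated at those of
    \<open>Q\<close>.\<close>
  case (5 P)
  then show ?case
    by (simp add: bipointed_two_category_def chosen_map_def id_two_map_def id_bimod_map_def
        chosen_obj_def Let_def)
next
  case (6 P Q R T S)
  then show ?case
    by (simp add: bipointed_two_category_def bipointed_two_functor_def chosen_map_def
        comp_two_map_def comp_bimod_map_def chosen_obj_def Let_def)
qed (auto simp: category_sBimod[unfolded sBimod_def] category_TwoCat2[unfolded TwoCat2_def]
    bimodular_category_chosen_obj bimod_morphism_chosen_map)

section \<open>The unit\<close>

lemma chosen_obj_coll_obj: "M \<noteq> N \<Longrightarrow> chosen_obj (coll_obj M N B) = B"
  by (simp add: chosen_obj_def coll_obj_def collage_def)

lemma chosen_map_coll_map: "M \<noteq> N \<Longrightarrow> chosen_map (coll_obj M N B) (coll_map M N \<phi>) = \<phi>"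
  by (simp add: chosen_map_def coll_obj_def coll_map_def)

lemma Coll_FA: "Arrow B \<phi> B' \<in> Arr sBimod \<Longrightarrow>
    FA (Coll M N) (Arrow B \<phi> B') = Arrow (coll_obj M N B) (coll_map M N \<phi>) (coll_obj M N B')"
  by (simp add: Coll_def)

lemma Chosen_FA: "Arrow P T Q \<in> Arr TwoCat2 \<Longrightarrow>
    FA Chosen (Arrow P T Q) = Arrow (chosen_obj P) (chosen_map P T) (chosen_obj Q)"
  by (simp add: Chosen_def)

lemma Chosen_Coll:
  fixes M N :: 'x
  assumes MN: "M \<noteq> N"
  shows "comp_functor (sBimod :: (('o, 'm) bimod, _) cat) Chosen (Coll M N) = id_functor sBimod"
proof (rule funct_eqI)
  show "is_functor sBimod sBimod (comp_functor sBimod Chosen (Coll M N))"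
    by (rule is_functor_comp_functor[OF is_functor_Coll[OF MN] is_functor_Chosen])
  show "is_functor sBimod sBimod (id_functor sBimod)"
    by (rule is_functor_id_functor[OF category_sBimod])
next
  fix B :: "('o, 'm) bimod" assume "B \<in> Obj sBimod"
  then show "FO (comp_functor sBimod Chosen (Coll M N)) B = FO (id_functor sBimod) B"
    by (simp add: sBimod_simps(1) Coll_def Chosen_def TwoCat2_simps(1)
        bipointed_two_category_coll_obj[OF MN] chosen_obj_coll_obj[OF MN])
next
  fix f :: "('o, 'm) bimod_arrow" assume f: "f \<in> Arr sBimod"
  obtain B \<phi> B' where eq: "f = Arrow B \<phi> B'" by (cases f)
  \<comment> \<open>\<open>FA Chosen\<close> is restricted to arrows of \<open>TwoCat2\<close>, so
    it can be evaluated only once the image under \<open>Coll\<close> is known to be one.\<close>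
  have "FA (Coll M N) f \<in> Arr TwoCat2"
    by (rule is_functor_FA[OF is_functor_Coll[OF MN] f])
  then show "FA (comp_functor sBimod Chosen (Coll M N)) f = FA (id_functor sBimod) f"
    using f by (simp add: eq Coll_FA Chosen_FA chosen_obj_coll_obj[OF MN] chosen_map_coll_map[OF MN])
qed

lemma nat_iso_Idn:
  assumes C: "category C"
  shows "nat_iso C C (id_functor C) (id_functor C) (Idn C)"
proof -
  have "Idn C \<in> Obj C \<rightarrow>\<^sub>E Arr C"
    using C by (simp add: category_def)
  moreover have "is_iso C (Idn C x)" if "x \<in> Obj C" for x
    using that category_Idn_in_Arr[OF C] category_Cmp_Idn[OF C, of "Idn C x"]
    by (auto simp: is_iso_def category_Dom_Cod_Idn[OF C] intro!: bexI[of _ "Idn C x"])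
  ultimately show ?thesis
    using C by (simp add: nat_iso_def nat_trans_def is_functor_id_functor category_Dom_Cod_Idn
        category_Dom_Cod category_Cmp_Idn)
qed

section \<open>The counit\<close>

definition counit_map :: "'x \<Rightarrow> 'x \<Rightarrow> ('x, 'o, 'm) bipointed \<Rightarrow> ('x, 'o, 'm) two_map" where
  "counit_map M N P =
    \<lparr>Zero = (\<lambda>x\<in>{M, N}. if x = M then PtM P else PtN P),
     HomF = HomF (coll_map M N (id_bimod_map (chosen_obj P)))\<rparr>"

text \<open>The homs of this collage between M, M and N, N and from M to N are literally homs of
  \<open>P\<close>, so identity functors serve as components and each nonvacuous law compares a
  composite in \<open>P\<close> with itself. Borrowing the components from \<open>coll_map\<close>
  of an identity also provides the \<open>empty_functor\<close> at Coll(N,M).\<close>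

lemma bipointed_two_functor_counit_map:
  assumes MN: "M \<noteq> N" and P: "bipointed_two_category P"
  shows "bipointed_two_functor (coll_obj M N (chosen_obj P)) P (counit_map M N P)"
proof -
  have A: "two_category (TwoCat P)" and pts: "PtM P \<in> Cell0 (TwoCat P)" "PtN P \<in> Cell0 (TwoCat P)"
    using P by (simp_all add: bipointed_two_category_def)
  note [simp] = functor_prod_catD[OF two_categoryD(2)[OF A]]
  show ?thesis
    using MN pts two_categoryD[OF A]
    unfolding bipointed_two_functor_def two_functor_def Let_def
    by (simp add: coll_obj_def collage_def counit_map_def coll_map_def id_bimod_map_def
        chosen_obj_def Let_def Obj_Arr_empty_cat is_functor_id_functor
        is_functor_empty_functor[OF category_empty_cat])
qed

text \<open>On the three inherited homs both sides are the component of \<open>T\<close>: the left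
  one precomposes it with an identity functor, the right one postcomposes it. On Coll(N,M) both are
  empty, and on 0-cells the equation says that \<open>T\<close> preserves the chosen ones.\<close>

lemma counit_map_natural:
  assumes MN: "M \<noteq> N" and P: "bipointed_two_category P" and Q: "bipointed_two_category Q"
    and T: "bipointed_two_functor P Q T"
  shows "comp_two_map (collage M N (chosen_obj P)) T (counit_map M N P) =
    comp_two_map (collage M N (chosen_obj P)) (counit_map M N Q) (coll_map M N (chosen_map P T))"
    (is "?l = ?r")
proof (rule two_map_eqI)
  let ?L = "coll_obj M N (chosen_obj P)"
  have L: "bipointed_two_category ?L"
    by (intro bipointed_two_category_coll_obj[OF MN] bimodular_category_chosen_obj P)
  have "bipointed_two_functor ?L Q ?l"
    using bipointed_two_functor_comp_two_map[OF L bipointed_two_functor_counit_map[OF MN P] T]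
    by (simp add: coll_obj_def)
  then show "two_functor (collage M N (chosen_obj P)) (TwoCat Q) ?l"
    by (simp add: bipointed_two_functor_def coll_obj_def)
  have "bipointed_two_functor ?L Q ?r"
    using bipointed_two_functor_comp_two_map[OF L
        bipointed_two_functor_coll_map[OF MN bimod_morphism_chosen_map[OF P T]]
        bipointed_two_functor_counit_map[OF MN Q]]
    by (simp add: coll_obj_def)
  then show "two_functor (collage M N (chosen_obj P)) (TwoCat Q) ?r"
    by (simp add: bipointed_two_functor_def coll_obj_def)
next
  fix x assume "x \<in> Cell0 (collage M N (chosen_obj P))"
  then show "Zero ?l x = Zero ?r x"
    using T MN by (auto simp: comp_two_map_simps)
      (auto simp: collage_def counit_map_def coll_map_def bipointed_two_functor_def)
next
  note F = bimod_morphismD[OF bimod_morphism_chosen_map[OF P T]]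
  note F = F[unfolded chosen_obj_def chosen_map_def Let_def, simplified]
  fix x y
  assume "x \<in> Cell0 (collage M N (chosen_obj P))" "y \<in> Cell0 (collage M N (chosen_obj P))"
  then show "HomF ?l x y = HomF ?r x y"
    using MN comp_functor_id_functor[OF F(1)] comp_functor_id_functor[OF F(2)]
      comp_functor_id_functor[OF F(3)]
    by (auto simp: comp_two_map_def collage_def counit_map_def coll_map_def id_bimod_map_def
        chosen_obj_def chosen_map_def Let_def comp_functor_empty_cat)
qed

text \<open>This is the content of the triangle identity for \<open>Coll\<close>:
  \<open>Chosen\<close> recovers \<open>B\<close>, and the chosen 0-cells of the collage are the
  labels themselves.\<close>

lemma counit_map_coll_obj:
  "M \<noteq> N \<Longrightarrow> counit_map M N (coll_obj M N B) = id_two_map (collage M N B)"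
  unfolding counit_map_def chosen_obj_coll_obj coll_map_id_bimod_map
  by (auto simp: id_two_map_def collage_def coll_obj_def fun_eq_iff)

text \<open>This is the content of the triangle identity for \<open>Chosen\<close>, which reads back
  exactly the three components where the counit is an identity functor.\<close>

lemma chosen_map_counit_map:
  "M \<noteq> N \<Longrightarrow> chosen_map (coll_obj M N (chosen_obj P)) (counit_map M N P) =
    id_bimod_map (chosen_obj P)"
  by (simp add: chosen_map_def coll_obj_def counit_map_def coll_map_def)

definition counit :: "'x \<Rightarrow> 'x \<Rightarrow> ('x, 'o, 'm) bipointed \<Rightarrow> ('x, 'o, 'm) bipointed_arrow" where
  "counit M N =
    (\<lambda>P\<in>Obj TwoCat2. Arrow (coll_obj M N (chosen_obj P)) (counit_map M N P) P)"

lemma counit_simps: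
  assumes "M \<noteq> N" "bipointed_two_category P"
  shows "counit M N P = Arrow (coll_obj M N (chosen_obj P)) (counit_map M N P) P"
    and "Arrow (coll_obj M N (chosen_obj P)) (counit_map M N P) P \<in> Arr TwoCat2"
  using assms by (simp_all add: counit_def TwoCat2_simps bipointed_two_category_coll_obj
      bimodular_category_chosen_obj bipointed_two_functor_counit_map)

lemma nat_trans_counit:
  fixes M N :: 'x
  assumes MN: "M \<noteq> N"
  shows "nat_trans (TwoCat2 :: (('x, 'o, 'm) bipointed, _) cat) TwoCat2
    (comp_functor TwoCat2 (Coll M N) Chosen) (id_functor TwoCat2) (counit M N)"
proof -
  let ?D = "TwoCat2 :: (('x, 'o, 'm) bipointed, _) cat"
  let ?LR = "comp_functor ?D (Coll M N) Chosen"
  have LR: "is_functor ?D ?D ?LR"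
    by (rule is_functor_comp_functor[OF is_functor_Chosen is_functor_Coll[OF MN]])
  have "counit M N \<in> extensional (Obj ?D)"
    by (simp add: counit_def)
  then have "counit M N \<in> Obj ?D \<rightarrow>\<^sub>E Arr ?D"
    by (auto simp: PiE_iff TwoCat2_simps(1) counit_simps[OF MN])
  moreover have "Dom ?D (counit M N P) = FO ?LR P \<and> Cod ?D (counit M N P) = FO (id_functor ?D) P"
    if "P \<in> Obj ?D" for P
    using that counit_simps[OF MN, of P]
    by (simp add: TwoCat2_simps(1,3,4) Coll_def Chosen_def sBimod_simps(1)
        bimodular_category_chosen_obj)
  moreover have "Cmp ?D (FA (id_functor ?D) f) (counit M N (Dom ?D f)) =
      Cmp ?D (counit M N (Cod ?D f)) (FA ?LR f)" if f: "f \<in> Arr ?D" for f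
  proof -
    obtain P T Q where eq: "f = Arrow P T Q" by (cases f)
    then have PQ: "bipointed_two_category P" "bipointed_two_category Q" "bipointed_two_functor P Q T"
      using f by (simp_all add: TwoCat2_simps)
    have R: "Arrow (chosen_obj P) (chosen_map P T) (chosen_obj Q) \<in> Arr sBimod"
      using is_functor_FA[OF is_functor_Chosen f] f by (simp add: eq Chosen_FA)
    have LRf: "FA ?LR f =
        Arrow (coll_obj M N (chosen_obj P)) (coll_map M N (chosen_map P T)) (coll_obj M N (chosen_obj Q))"
      using f R by (simp add: eq Chosen_FA Coll_FA)
    \<comment> \<open>This gives the typing needed to evaluate the second composite with
      \<open>TwoCat2_Cmp\<close>. What remains is \<open>counit_map_natural\<close>, up to unfolding
      \<open>coll_obj\<close>.\<close>
    moreover have "FA ?LR f \<in> Arr ?D"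
      by (rule is_functor_FA[OF LR f])
    ultimately show ?thesis
      using f counit_simps[OF MN PQ(1)] counit_simps[OF MN PQ(2)] counit_map_natural[OF MN PQ]
      by (simp add: TwoCat2_simps(3,4) TwoCat2_Cmp eq) (simp add: coll_obj_def)
  qed
  ultimately show ?thesis
    using LR is_functor_id_functor[OF category_TwoCat2] by (simp add: nat_trans_def)
qed

theorem theorem2p6:
  fixes M N :: 'x
  assumes "M \<noteq> N"
  shows "\<exists>(\<eta> :: ('o, 'm) bimod \<Rightarrow> ('o, 'm) bimod_arrow)
            (\<epsilon> :: ('x, 'o, 'm) bipointed \<Rightarrow> ('x, 'o, 'm) bipointed_arrow).
           adjunction sBimod TwoCat2 (Coll M N) Chosen \<eta> \<epsilon> \<and>
           nat_iso sBimod sBimod (id_functor sBimod)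
             (comp_functor sBimod Chosen (Coll M N)) \<eta>"
proof (intro exI conjI)
  let ?C = "sBimod :: (('o, 'm) bimod, _) cat"
  let ?D = "TwoCat2 :: (('x, 'o, 'm) bipointed, _) cat"
  \<comment> \<open>Proving the second conjunct first instantiates the unit with
    \<open>Idn ?C\<close>; the counit is instantiated by the final \<open>show\<close>.\<close>
  show iso: "nat_iso ?C ?C (id_functor ?C) (comp_functor ?C Chosen (Coll M N)) (Idn ?C)"
    unfolding Chosen_Coll[OF assms] by (rule nat_iso_Idn[OF category_sBimod])
  \<comment> \<open>The triangle identity for \<open>Coll\<close>: both factors are the identity of
    the collage, the second by functoriality of \<open>Coll\<close>.\<close>
  have "Cmp ?D (counit M N (FO (Coll M N) B)) (FA (Coll M N) (Idn ?C B)) = Idn ?D (FO (Coll M N) B)"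
    if "B \<in> Obj ?C" for B
  proof -
    let ?P = "coll_obj M N B"
    have L: "FO (Coll M N) B = ?P"
      using that by (simp add: Coll_def)
    have P: "?P \<in> Obj ?D"
      using is_functor_FO[OF is_functor_Coll[OF assms] that] by (simp add: L)
    have "counit M N ?P = Idn ?D ?P"
      using P by (simp add: TwoCat2_simps counit_simps[OF assms] chosen_obj_coll_obj[OF assms]
          counit_map_coll_obj[OF assms]) (simp add: coll_obj_def)
    moreover have "FA (Coll M N) (Idn ?C B) = Idn ?D ?P"
      using is_functor_Idn[OF is_functor_Coll[OF assms] that] by (simp add: L)
    ultimately show ?thesis
      using category_Cmp_Idn(1)[OF category_TwoCat2 category_Idn_in_Arr[OF category_TwoCat2 P]]
      by (simp add: L category_Dom_Cod_Idn[OF category_TwoCat2 P])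
  qed
  \<comment> \<open>The triangle identity for \<open>Chosen\<close>, with the unit already written
    as an identity arrow.\<close>
  moreover have "Cmp ?C (FA Chosen (counit M N P)) (Idn ?C (FO Chosen P)) = Idn ?C (FO Chosen P)"
    if "P \<in> Obj ?D" for P
  proof -
    have P: "bipointed_two_category P" and R: "FO Chosen P = chosen_obj P"
      using that by (simp_all add: TwoCat2_simps Chosen_def)
    have B: "chosen_obj P \<in> Obj ?C"
      using bimodular_category_chosen_obj[OF P] by (simp add: sBimod_simps)
    then have "FA Chosen (counit M N P) = Idn ?C (chosen_obj P)"
      using counit_simps[OF assms P]
      by (simp add: Chosen_FA chosen_obj_coll_obj[OF assms] chosen_map_counit_map[OF assms]
          sBimod_simps)
    then show ?thesis
      using category_Cmp_Idn(1)[OF category_sBimod category_Idn_in_Arr[OF category_sBimod B]]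
      by (simp add: R category_Dom_Cod_Idn[OF category_sBimod B])
  qed
  ultimately show "adjunction ?C ?D (Coll M N) Chosen (Idn ?C) (counit M N)"
    using iso is_functor_Coll[OF assms] is_functor_Chosen nat_trans_counit[OF assms]
    by (simp add: adjunction_def nat_iso_def)
qed

end
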